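(* For every integer $m \ge 5$, there exists a pentagonal geometry $\mathrm{PENT}(3, 6m+3)$ with connected deficiency graph.
   Context: A partial linear space is a non-empty finite set of points together with a collection of subsets, called lines (or blocks), such that every line contains at least two points and any two distinct points lie together on at most one line. Two distinct points are collinear if some line contains both. For integers $k \ge 2$, $r \ge 1$, a pentagonal geometry $\mathrm{PENT}(k,r)$ is a partial linear space in which every line contains exactly $k$ points, every point lies on exactly $r$ lines, and for each point $x$ there is a line, denoted $x^{\mathrm{opp}}$, consisting of precisely those points $y \ne x$ that are not collinear with $x$. The deficiency graph of a pentagonal geometry has the points as vertices, with an edge joining distinct points $x$ and $y$ precisely when $x$ and $y$ are not collinear. *)

theory Defs
  imports "Graph_Theory.Digraph_Component"
begin

locale partial_linear_space =
  fixes points :: "'a set" and lines :: "'a set set"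
  assumes finite_points: "finite points"
    and points_nonempty: "points \<noteq> {}"
    and line_subset: "L \<in> lines \<Longrightarrow> L \<subseteq> points"
    and line_card: "L \<in> lines \<Longrightarrow> 2 \<le> card L"
    and at_most_one_line:
      "\<lbrakk>x \<in> points; y \<in> points; x \<noteq> y;
        L \<in> lines; x \<in> L; y \<in> L; M \<in> lines; x \<in> M; y \<in> M\<rbrakk> \<Longrightarrow> L = M"

definition collinear_in :: "'a set set \<Rightarrow> 'a \<Rightarrow> 'a \<Rightarrow> bool" where
  "collinear_in lines x y \<longleftrightarrow> x \<noteq> y \<and> (\<exists>L\<in>lines. x \<in> L \<and> y \<in> L)"

text \<open>The \<open>L\<close> in \<open>opposite_line\<close> is the line usually written \<open>x\<^sup>o\<^sup>p\<^sup>p\<close>, which is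
  uniquely determined by \<open>x\<close>.\<close>

locale pentagonal_geometry = partial_linear_space points lines
  for points :: "'a set" and lines :: "'a set set" +
  fixes k r :: nat
  assumes k_ge_2: "2 \<le> k"
    and r_ge_1: "1 \<le> r"
    and line_size: "L \<in> lines \<Longrightarrow> card L = k"
    and point_degree: "x \<in> points \<Longrightarrow> card {L \<in> lines. x \<in> L} = r"
    and opposite_line:
      "x \<in> points \<Longrightarrow>
        \<exists>L\<in>lines. L = {y \<in> points. y \<noteq> x \<and> \<not> collinear_in lines x y}"

text \<open>An undirected edge is represented, as usual for \<open>pair_graph\<close>, by its two arcs.\<close>

definition deficiency_graph :: "'a set \<Rightarrow> 'a set set \<Rightarrow> 'a pair_pre_digraph" where
  "deficiency_graph points lines =
    \<lparr> pverts = points,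
      parcs = {(x, y). x \<in> points \<and> y \<in> points \<and> x \<noteq> y \<and> \<not> collinear_in lines x y} \<rparr>"

lemma collinear_in_sym: "collinear_in lines x y \<longleftrightarrow> collinear_in lines y x"
  unfolding collinear_in_def by auto

lemma (in partial_linear_space) pair_graph_deficiency_graph:
  "pair_graph (deficiency_graph points lines)"
proof
  have "parcs (deficiency_graph points lines) \<subseteq> points \<times> points"
    by (auto simp: deficiency_graph_def)
  then show "finite (parcs (deficiency_graph points lines))"
    using finite_points by (meson finite_SigmaI finite_subset)
  show "symmetric (with_proj (deficiency_graph points lines))"
    unfolding symmetric_def sym_def
    by (auto simp: deficiency_graph_def collinear_in_sym)
qed (use finite_points in \<open>auto simp: deficiency_graph_def\<close>)

end

theory Submission
  imports Defs
begin

text \<open>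
  Put \<open>n = 6m + 5\<close> and take as points two copies of \<open>\<int>/n\<close>, the rim and the inner circle.  The
  deficiency graph is the generalized Petersen graph with steps 1 (rim) and 2 (inner circle), and all
  lines are translates of base lines: \<open>{-1, 1}\<close> on the rim with \<open>0\<close> inside; \<open>0\<close> on the rim with
  \<open>{x, -x}\<close> inside, for \<open>2 \<le> x \<le> 3m + 2\<close>; and rim triangles \<open>{0, a, a + b}\<close>.  The first two kinds
  use up the rim difference 2, all inner differences but 2, and all mixed differences but 0.  What
  is left is to split the rim differences \<open>3, \<dots>, 3m + 2\<close> into \<open>m\<close> triples with \<open>a + b = c\<close> or
  \<open>a + b + c = n\<close>.  This is a (hooked) Langford sequence of defect 3.

  Only covering has to be checked: there are just enough lines to join the non-edges of the
  graph once, so no pair is joined twice and no edge is joined at all.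
\<close>

section \<open>Langford triples\<close>

text \<open>The differences \<open>c\<close> and \<open>n - c\<close> agree modulo \<open>n\<close> up to sign; \<open>n - c\<close> is truncated to the
  harmless value 0 if \<open>c > n\<close>.\<close>

definition triple_cover :: "nat \<Rightarrow> (nat \<times> nat \<times> nat) list \<Rightarrow> nat set" where
  "triple_cover n ts = (\<Union>(a, b, c)\<in>set ts. {a, b, c, n - c})"

text \<open>At most one of \<open>c\<close> and \<open>n - c\<close> lies in the target interval, so
  \<open>m\<close> triples offer at most 3m differences for its 3m values, and covering them amounts
  to partitioning them. A sum \<open>c\<close> above 3m + 2 stands for the relation a + b + (n - c)
  = n.\<close>

definition difference_triples :: "nat \<Rightarrow> (nat \<times> nat \<times> nat) list \<Rightarrow> bool" where
  "difference_triples m ts \<longleftrightarrow> length ts = m \<and> (\<forall>(a, b, c)\<in>set ts. a + b = c) \<and>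
     {3..<3 * m + 3} \<subseteq> triple_cover (6 * m + 5) ts"

lemma triple_cover_simps [simp]:
  "triple_cover n [] = {}"
  "triple_cover n ((a, b, c) # ts) = {a, b, c, n - c} \<union> triple_cover n ts"
  "triple_cover n (ts @ us) = triple_cover n ts \<union> triple_cover n us"
  by (auto simp: triple_cover_def)

text \<open>The shape of the long runs of nested pairs in Skolem's and Langford's sequences.\<close>

definition triple_run :: "nat \<Rightarrow> nat \<Rightarrow> nat \<Rightarrow> nat \<Rightarrow> (nat \<times> nat \<times> nat) list" where
  "triple_run a b c l = map (\<lambda>r. (a + 2 * r, b - Suc r, c + r)) [0..<l]"

lemma length_triple_run [simp]: "length (triple_run a b c l) = l"
  by (simp add: triple_run_def)

text \<open>Along a run the entries change by 2, -1 and 1, so the relation a + (b - 1) = c at index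
  0 persists. The bound on \<open>l\<close> keeps the subtraction from truncating.\<close>

lemma triple_run_sum:
  assumes "(x, y, z) \<in> set (triple_run a b c l)" "a + b = Suc c" "l \<le> b"
  shows "x + y = z"
  using assms by (auto simp: triple_run_def)

text \<open>First entries advance by 2 and fill one parity class only, whereas second and third
  entries fill whole intervals. Small differences therefore need separate runs for even and odd
  values.\<close>

lemma triple_run_cover_fst:
  assumes "a \<le> d" "d < a + 2 * l" "even d \<longleftrightarrow> even a"
  shows "d \<in> triple_cover n (triple_run a b c l)"
proof -
  have "\<exists>r. d = a + 2 * r"
    using assms(1,3) by presburger
  then obtain r where "d = a + 2 * r" ..
  moreover from this have "r < l" using assms(2) by simp
  ultimately show ?thesis by (auto simp: triple_cover_def triple_run_def)
qed

lemma triple_run_cover_snd: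
  assumes "b = k + l"
  shows "{k..<b} \<subseteq> triple_cover n (triple_run a b c l)"
proof
  fix d assume "d \<in> {k..<b}"
  then have "d = b - Suc (b - Suc d)" "b - Suc d < l" using assms by auto
  then show "d \<in> triple_cover n (triple_run a b c l)"
    by (force simp: triple_cover_def triple_run_def)
qed

lemma triple_run_cover_thd: "{c..<c + l} \<subseteq> triple_cover n (triple_run a b c l)"
proof
  fix d assume "d \<in> {c..<c + l}"
  then have "d = c + (d - c)" "d - c < l" by auto
  then show "d \<in> triple_cover n (triple_run a b c l)"
    by (force simp: triple_cover_def triple_run_def)
qed

text \<open>Declared as a transitivity rule so that adjacent intervals can be glued by
  \<open>also\<close> and \<open>finally\<close>.\<close>

lemma ivl_subset_trans [trans]:
  fixes l m k :: nat
  shows "{l..<m} \<subseteq> C \<Longrightarrow> {m..<k} \<subseteq> C \<Longrightarrow> {l..<k} \<subseteq> C"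
  by (meson atLeastLessThan_iff in_mono linorder_not_le subsetI)

section \<open>Langford triples for m >= 16, by residue modulo 4\<close>

text \<open>Three runs, whose lengths grow linearly in \<open>u\<close>, produce all but fourteen
  triples. Their second and third entries fill six long intervals, their first entries most of the
  small differences; the sporadic triples \<open>sp\<close> plug the gaps. Every sum is at most 3m +
  2 = 12u + 50, so this is a Langford sequence without a hook.\<close>

lemma difference_triples_mod4_0: "\<exists>ts. difference_triples (4 * u + 16) ts"
proof -
  define r1 r2 r3 where "r1 = triple_run 8 (10 * u + 42) (10 * u + 49) (2 * u + 2)"
    and "r2 = triple_run (2 * u + 15) (5 * u + 21) (7 * u + 35) u"
    and "r3 = triple_run 5 (6 * u + 29) (6 * u + 33) u"
  note run_defs = r1_def r2_def r3_def
  define sp where "sp =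
    [(4 * u + 12, 6 * u + 31, 10 * u + 43),
     (4 * u + 14, 6 * u + 30, 10 * u + 44),
     (4 * u + 15, 6 * u + 32, 10 * u + 47),
     (4 * u + 18, 4 * u + 20, 8 * u + 38),
     (4 * u + 17, 4 * u + 19, 8 * u + 36),
     (4 * u + 16, 6 * u + 29, 10 * u + 45),
     (2 * u + 13, 8 * u + 35, 10 * u + 48),
     (2 * u + 11, 5 * u + 22, 7 * u + 33),
     (2 * u + 5, 8 * u + 37, 10 * u + 42),
     (2 * u + 9, 5 * u + 25, 7 * u + 34),
     (2 * u + 7, 8 * u + 39, 10 * u + 46),
     (6, 5 * u + 21, 5 * u + 27),
     (4, 5 * u + 24, 5 * u + 28),
     (3, 5 * u + 23, 5 * u + 26)]"
  define ts where "ts = sp @ r1 @ r2 @ r3"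
  define C where "C = triple_cover (6 * (4 * u + 16) + 5) ts"
  have sp: "{3, 4, 6, 2 * u + 5, 2 * u + 7, 2 * u + 9, 2 * u + 11, 2 * u + 13,
    4 * u + 12, 4 * u + 14, 4 * u + 15, 4 * u + 16, 4 * u + 17, 4 * u + 18, 4 * u + 19, 4 * u + 20,
    5 * u + 21, 5 * u + 22, 5 * u + 23, 5 * u + 24, 5 * u + 25, 5 * u + 26, 5 * u + 27, 5 * u + 28,
    6 * u + 29, 6 * u + 30, 6 * u + 31, 6 * u + 32, 7 * u + 33, 7 * u + 34, 8 * u + 35, 8 * u + 36,
    8 * u + 37, 8 * u + 38, 8 * u + 39, 10 * u + 42, 10 * u + 43, 10 * u + 44, 10 * u + 45, 10 * u + 46,
    10 * u + 47, 10 * u + 48} \<subseteq> C"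
    by (simp add: C_def ts_def sp_def)
  \<comment> \<open>Among the small values, \<open>r1\<close> supplies the even ones from 8 on,
    \<open>r3\<close> the odd ones from 5, and \<open>r2\<close> the odd ones from 2u + 15; the
    exceptions are in \<open>sp\<close>.\<close>
  have low: "d \<in> C" if "3 \<le> d" "d < 4 * u + 14" for d
  proof (cases "even d")
    case True
    then have "d = 4 \<or> d = 6 \<or> d = 4 * u + 12 \<or> (8 \<le> d \<and> d < 4 * u + 12)"
      using that by presburger
    then show ?thesis
      using sp triple_run_cover_fst[of _ d] True
      by (elim disjE) (auto simp: C_def ts_def run_defs)
  next
    case False
    then have "d = 3 \<or> d = 2 * u + 5 \<or> d = 2 * u + 7 \<or> d = 2 * u + 9 \<or> d = 2 * u + 11 \<or>
        d = 2 * u + 13 \<or> (2 * u + 15 \<le> d \<and> d < 4 * u + 15) \<or> (5 \<le> d \<and> d < 2 * u + 5)"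
      using that by presburger
    then show ?thesis
      using sp triple_run_cover_fst[of _ d] False
      by (elim disjE) (auto simp: C_def ts_def run_defs)
  qed
  \<comment> \<open>The target interval is tiled from left to right, with short sporadic blocks
    between the long intervals. Those come, in order, from the second entries of \<open>r2\<close>
    and \<open>r3\<close>, the third entries of \<open>r3\<close> and \<open>r2\<close>, and the
    second and third entries of \<open>r1\<close>.\<close>
  have "{3..<4 * u + 14} \<subseteq> C"
    using low by auto
  also have "{4 * u + 14..<4 * u + 21} \<subseteq> C"
    by (rule subset_trans[OF _ sp]) (simp add: subset_iff, presburger)
  also have "{4 * u + 21..<5 * u + 21} \<subseteq> C"
    using triple_run_cover_snd[of "5 * u + 21" "4 * u + 21" "u"]
    by (fastforce simp: C_def ts_def run_defs)
  also have "{5 * u + 21..<5 * u + 29} \<subseteq> C"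
    by (rule subset_trans[OF _ sp]) (simp add: subset_iff, presburger)
  also have "{5 * u + 29..<6 * u + 29} \<subseteq> C"
    using triple_run_cover_snd[of "6 * u + 29" "5 * u + 29" "u"]
    by (fastforce simp: C_def ts_def run_defs)
  also have "{6 * u + 29..<6 * u + 33} \<subseteq> C"
    by (rule subset_trans[OF _ sp]) (simp add: subset_iff, presburger)
  also have "{6 * u + 33..<7 * u + 33} \<subseteq> C"
    using triple_run_cover_thd[of "6 * u + 33" "u"]
    by (fastforce simp: C_def ts_def run_defs)
  also have "{7 * u + 33..<7 * u + 35} \<subseteq> C"
    by (rule subset_trans[OF _ sp]) (simp add: subset_iff, presburger)
  also have "{7 * u + 35..<8 * u + 35} \<subseteq> C"
    using triple_run_cover_thd[of "7 * u + 35" "u"]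
    by (fastforce simp: C_def ts_def run_defs)
  also have "{8 * u + 35..<8 * u + 40} \<subseteq> C"
    by (rule subset_trans[OF _ sp]) (simp add: subset_iff, presburger)
  also have "{8 * u + 40..<10 * u + 42} \<subseteq> C"
    using triple_run_cover_snd[of "10 * u + 42" "8 * u + 40" "2 * u + 2"]
    by (fastforce simp: C_def ts_def run_defs)
  also have "{10 * u + 42..<10 * u + 49} \<subseteq> C"
    by (rule subset_trans[OF _ sp]) (simp add: subset_iff, presburger)
  also have "{10 * u + 49..<12 * u + 51} \<subseteq> C"
    using triple_run_cover_thd[of "10 * u + 49" "2 * u + 2"]
    by (fastforce simp: C_def ts_def run_defs)
  finally have "{3..<3 * (4 * u + 16) + 3} \<subseteq> C" by (simp add: add.commute)
  moreover have "\<forall>(a, b, c)\<in>set ts. a + b = c"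
    by (auto simp: ts_def sp_def run_defs dest: triple_run_sum)
  moreover have "length ts = 4 * u + 16"
    by (simp add: ts_def sp_def run_defs)
  ultimately show ?thesis
    by (auto simp: difference_triples_def C_def)
qed

text \<open>Same pattern with a longer \<open>r1\<close>. The largest difference 3m + 2 = 12u + 53
  is now the sum of a sporadic triple, and again no hook occurs.\<close>

lemma difference_triples_mod4_1: "\<exists>ts. difference_triples (4 * u + 17) ts"
proof -
  define r1 r2 r3 where "r1 = triple_run 8 (10 * u + 43) (10 * u + 50) (2 * u + 3)"
    and "r2 = triple_run (2 * u + 15) (5 * u + 21) (7 * u + 35) u"
    and "r3 = triple_run 5 (6 * u + 29) (6 * u + 33) u"
  note run_defs = r1_def r2_def r3_def
  define sp where "sp =
    [(4 * u + 19, 4 * u + 20, 8 * u + 39),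
     (2 * u + 13, 8 * u + 35, 10 * u + 48),
     (4 * u + 18, 6 * u + 29, 10 * u + 47),
     (4 * u + 17, 6 * u + 32, 10 * u + 49),
     (4 * u + 16, 8 * u + 37, 12 * u + 53),
     (4 * u + 15, 6 * u + 31, 10 * u + 46),
     (4 * u + 14, 6 * u + 30, 10 * u + 44),
     (2 * u + 11, 5 * u + 23, 7 * u + 34),
     (2 * u + 9, 8 * u + 36, 10 * u + 45),
     (2 * u + 7, 5 * u + 26, 7 * u + 33),
     (2 * u + 5, 8 * u + 38, 10 * u + 43),
     (6, 5 * u + 21, 5 * u + 27),
     (4, 5 * u + 24, 5 * u + 28),
     (3, 5 * u + 22, 5 * u + 25)]"
  define ts where "ts = sp @ r1 @ r2 @ r3"
  define C where "C = triple_cover (6 * (4 * u + 17) + 5) ts"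
  have sp: "{3, 4, 6, 2 * u + 5, 2 * u + 7, 2 * u + 9, 2 * u + 11, 2 * u + 13,
    4 * u + 14, 4 * u + 15, 4 * u + 16, 4 * u + 17, 4 * u + 18, 4 * u + 19, 4 * u + 20, 5 * u + 21,
    5 * u + 22, 5 * u + 23, 5 * u + 24, 5 * u + 25, 5 * u + 26, 5 * u + 27, 5 * u + 28, 6 * u + 29,
    6 * u + 30, 6 * u + 31, 6 * u + 32, 7 * u + 33, 7 * u + 34, 8 * u + 35, 8 * u + 36, 8 * u + 37,
    8 * u + 38, 8 * u + 39, 10 * u + 43, 10 * u + 44, 10 * u + 45, 10 * u + 46, 10 * u + 47, 10 * u + 48,
    10 * u + 49, 12 * u + 53} \<subseteq> C"
    by (simp add: C_def ts_def sp_def)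
  have low: "d \<in> C" if "3 \<le> d" "d < 4 * u + 14" for d
  proof (cases "even d")
    case True
    then have "d = 4 \<or> d = 6 \<or> (8 \<le> d \<and> d < 4 * u + 14)"
      using that by presburger
    then show ?thesis
      using sp triple_run_cover_fst[of _ d] True
      by (elim disjE) (auto simp: C_def ts_def run_defs)
  next
    case False
    then have "d = 3 \<or> d = 2 * u + 5 \<or> d = 2 * u + 7 \<or> d = 2 * u + 9 \<or> d = 2 * u + 11 \<or>
        d = 2 * u + 13 \<or> (2 * u + 15 \<le> d \<and> d < 4 * u + 15) \<or> (5 \<le> d \<and> d < 2 * u + 5)"
      using that by presburger
    then show ?thesis
      using sp triple_run_cover_fst[of _ d] False
      by (elim disjE) (auto simp: C_def ts_def run_defs)
  qed
  have "{3..<4 * u + 14} \<subseteq> C"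
    using low by auto
  also have "{4 * u + 14..<4 * u + 21} \<subseteq> C"
    by (rule subset_trans[OF _ sp]) (simp add: subset_iff, presburger)
  also have "{4 * u + 21..<5 * u + 21} \<subseteq> C"
    using triple_run_cover_snd[of "5 * u + 21" "4 * u + 21" "u"]
    by (fastforce simp: C_def ts_def run_defs)
  also have "{5 * u + 21..<5 * u + 29} \<subseteq> C"
    by (rule subset_trans[OF _ sp]) (simp add: subset_iff, presburger)
  also have "{5 * u + 29..<6 * u + 29} \<subseteq> C"
    using triple_run_cover_snd[of "6 * u + 29" "5 * u + 29" "u"]
    by (fastforce simp: C_def ts_def run_defs)
  also have "{6 * u + 29..<6 * u + 33} \<subseteq> C"
    by (rule subset_trans[OF _ sp]) (simp add: subset_iff, presburger)
  also have "{6 * u + 33..<7 * u + 33} \<subseteq> C"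
    using triple_run_cover_thd[of "6 * u + 33" "u"]
    by (fastforce simp: C_def ts_def run_defs)
  also have "{7 * u + 33..<7 * u + 35} \<subseteq> C"
    by (rule subset_trans[OF _ sp]) (simp add: subset_iff, presburger)
  also have "{7 * u + 35..<8 * u + 35} \<subseteq> C"
    using triple_run_cover_thd[of "7 * u + 35" "u"]
    by (fastforce simp: C_def ts_def run_defs)
  also have "{8 * u + 35..<8 * u + 40} \<subseteq> C"
    by (rule subset_trans[OF _ sp]) (simp add: subset_iff, presburger)
  also have "{8 * u + 40..<10 * u + 43} \<subseteq> C"
    using triple_run_cover_snd[of "10 * u + 43" "8 * u + 40" "2 * u + 3"]
    by (fastforce simp: C_def ts_def run_defs)
  also have "{10 * u + 43..<10 * u + 50} \<subseteq> C"
    by (rule subset_trans[OF _ sp]) (simp add: subset_iff, presburger)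
  also have "{10 * u + 50..<12 * u + 53} \<subseteq> C"
    using triple_run_cover_thd[of "10 * u + 50" "2 * u + 3"]
    by (fastforce simp: C_def ts_def run_defs)
  also have "{12 * u + 53..<12 * u + 54} \<subseteq> C"
    by (rule subset_trans[OF _ sp]) (simp add: subset_iff)
  finally have "{3..<3 * (4 * u + 17) + 3} \<subseteq> C" by (simp add: add.commute)
  moreover have "\<forall>(a, b, c)\<in>set ts. a + b = c"
    by (auto simp: ts_def sp_def run_defs dest: triple_run_sum)
  moreover have "length ts = 4 * u + 17"
    by (simp add: ts_def sp_def run_defs)
  ultimately show ?thesis
    by (auto simp: difference_triples_def C_def)
qed

text \<open>Here 3 + ... + (3m + 2) is odd, so the triples of the partition cannot all satisfy a + b
  = c within the interval. One sporadic sum is 12u + 57 = 3m + 3, and it covers 3m + 2 as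
  \<open>n - c\<close>: this is the hook.\<close>

lemma difference_triples_mod4_2: "\<exists>ts. difference_triples (4 * u + 18) ts"
proof -
  define r1 r2 r3 where "r1 = triple_run 8 (10 * u + 43) (10 * u + 50) (2 * u + 4)"
    and "r2 = triple_run (2 * u + 15) (5 * u + 21) (7 * u + 35) u"
    and "r3 = triple_run 5 (6 * u + 29) (6 * u + 33) u"
  note run_defs = r1_def r2_def r3_def
  define sp where "sp =
    [(4 * u + 20, 6 * u + 29, 10 * u + 49),
     (6, 5 * u + 21, 5 * u + 27),
     (2 * u + 13, 10 * u + 44, 12 * u + 57),
     (4 * u + 19, 8 * u + 35, 12 * u + 54),
     (4 * u + 18, 8 * u + 37, 12 * u + 55),
     (4 * u + 17, 6 * u + 30, 10 * u + 47),
     (4 * u + 16, 6 * u + 32, 10 * u + 48),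
     (4 * u + 15, 6 * u + 31, 10 * u + 46),
     (2 * u + 11, 5 * u + 23, 7 * u + 34),
     (2 * u + 9, 8 * u + 36, 10 * u + 45),
     (2 * u + 7, 5 * u + 26, 7 * u + 33),
     (2 * u + 5, 8 * u + 38, 10 * u + 43),
     (4, 5 * u + 24, 5 * u + 28),
     (3, 5 * u + 22, 5 * u + 25)]"
  define ts where "ts = sp @ r1 @ r2 @ r3"
  define C where "C = triple_cover (6 * (4 * u + 18) + 5) ts"
  have sp: "{3, 4, 6, 2 * u + 5, 2 * u + 7, 2 * u + 9, 2 * u + 11, 2 * u + 13,
    4 * u + 15, 4 * u + 16, 4 * u + 17, 4 * u + 18, 4 * u + 19, 4 * u + 20, 5 * u + 21, 5 * u + 22,
    5 * u + 23, 5 * u + 24, 5 * u + 25, 5 * u + 26, 5 * u + 27, 5 * u + 28, 6 * u + 29, 6 * u + 30,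
    6 * u + 31, 6 * u + 32, 7 * u + 33, 7 * u + 34, 8 * u + 35, 8 * u + 36, 8 * u + 37, 8 * u + 38,
    10 * u + 43, 10 * u + 44, 10 * u + 45, 10 * u + 46, 10 * u + 47, 10 * u + 48, 10 * u + 49, 12 * u + 54,
    12 * u + 55, 12 * u + 56} \<subseteq> C"
    by (simp add: C_def ts_def sp_def)
  have low: "d \<in> C" if "3 \<le> d" "d < 4 * u + 15" for d
  proof (cases "even d")
    case True
    then have "d = 4 \<or> d = 6 \<or> (8 \<le> d \<and> d < 4 * u + 16)"
      using that by presburger
    then show ?thesis
      using sp triple_run_cover_fst[of _ d] True
      by (elim disjE) (auto simp: C_def ts_def run_defs)
  next
    case False
    then have "d = 3 \<or> d = 2 * u + 5 \<or> d = 2 * u + 7 \<or> d = 2 * u + 9 \<or> d = 2 * u + 11 \<or>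
        d = 2 * u + 13 \<or> (2 * u + 15 \<le> d \<and> d < 4 * u + 15) \<or> (5 \<le> d \<and> d < 2 * u + 5)"
      using that by presburger
    then show ?thesis
      using sp triple_run_cover_fst[of _ d] False
      by (elim disjE) (auto simp: C_def ts_def run_defs)
  qed
  have "{3..<4 * u + 15} \<subseteq> C"
    using low by auto
  also have "{4 * u + 15..<4 * u + 21} \<subseteq> C"
    by (rule subset_trans[OF _ sp]) (simp add: subset_iff, presburger)
  also have "{4 * u + 21..<5 * u + 21} \<subseteq> C"
    using triple_run_cover_snd[of "5 * u + 21" "4 * u + 21" "u"]
    by (fastforce simp: C_def ts_def run_defs)
  also have "{5 * u + 21..<5 * u + 29} \<subseteq> C"
    by (rule subset_trans[OF _ sp]) (simp add: subset_iff, presburger)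
  also have "{5 * u + 29..<6 * u + 29} \<subseteq> C"
    using triple_run_cover_snd[of "6 * u + 29" "5 * u + 29" "u"]
    by (fastforce simp: C_def ts_def run_defs)
  also have "{6 * u + 29..<6 * u + 33} \<subseteq> C"
    by (rule subset_trans[OF _ sp]) (simp add: subset_iff, presburger)
  also have "{6 * u + 33..<7 * u + 33} \<subseteq> C"
    using triple_run_cover_thd[of "6 * u + 33" "u"]
    by (fastforce simp: C_def ts_def run_defs)
  also have "{7 * u + 33..<7 * u + 35} \<subseteq> C"
    by (rule subset_trans[OF _ sp]) (simp add: subset_iff, presburger)
  also have "{7 * u + 35..<8 * u + 35} \<subseteq> C"
    using triple_run_cover_thd[of "7 * u + 35" "u"]
    by (fastforce simp: C_def ts_def run_defs)
  also have "{8 * u + 35..<8 * u + 39} \<subseteq> C"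
    by (rule subset_trans[OF _ sp]) (simp add: subset_iff, presburger)
  also have "{8 * u + 39..<10 * u + 43} \<subseteq> C"
    using triple_run_cover_snd[of "10 * u + 43" "8 * u + 39" "2 * u + 4"]
    by (fastforce simp: C_def ts_def run_defs)
  also have "{10 * u + 43..<10 * u + 50} \<subseteq> C"
    by (rule subset_trans[OF _ sp]) (simp add: subset_iff, presburger)
  also have "{10 * u + 50..<12 * u + 54} \<subseteq> C"
    using triple_run_cover_thd[of "10 * u + 50" "2 * u + 4"]
    by (fastforce simp: C_def ts_def run_defs)
  also have "{12 * u + 54..<12 * u + 57} \<subseteq> C"
    by (rule subset_trans[OF _ sp]) (simp add: subset_iff, presburger)
  finally have "{3..<3 * (4 * u + 18) + 3} \<subseteq> C" by (simp add: add.commute)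
  moreover have "\<forall>(a, b, c)\<in>set ts. a + b = c"
    by (auto simp: ts_def sp_def run_defs dest: triple_run_sum)
  moreover have "length ts = 4 * u + 18"
    by (simp add: ts_def sp_def run_defs)
  ultimately show ?thesis
    by (auto simp: difference_triples_def C_def)
qed

text \<open>The sum of the differences is odd again. The hook is the sporadic sum 12u + 60 = 3m + 3,
  which covers 3m + 2 = 12u + 59.\<close>

lemma difference_triples_mod4_3: "\<exists>ts. difference_triples (4 * u + 19) ts"
proof -
  define r1 r2 r3 where "r1 = triple_run 8 (10 * u + 47) (10 * u + 54) (2 * u + 4)"
    and "r2 = triple_run (2 * u + 15) (5 * u + 23) (7 * u + 37) (u + 1)"
    and "r3 = triple_run 5 (6 * u + 31) (6 * u + 35) u"
  note run_defs = r1_def r2_def r3_def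
  define sp where "sp =
    [(4 * u + 21, 6 * u + 31, 10 * u + 52),
     (4 * u + 20, 6 * u + 33, 10 * u + 53),
     (6, 5 * u + 23, 5 * u + 29),
     (2 * u + 13, 8 * u + 38, 10 * u + 51),
     (4 * u + 19, 8 * u + 41, 12 * u + 60),
     (4 * u + 17, 6 * u + 32, 10 * u + 49),
     (4 * u + 18, 8 * u + 40, 12 * u + 58),
     (4 * u + 16, 6 * u + 34, 10 * u + 50),
     (2 * u + 7, 5 * u + 28, 7 * u + 35),
     (2 * u + 11, 5 * u + 25, 7 * u + 36),
     (2 * u + 9, 8 * u + 39, 10 * u + 48),
     (2 * u + 5, 8 * u + 42, 10 * u + 47),
     (4, 5 * u + 26, 5 * u + 30),
     (3, 5 * u + 24, 5 * u + 27)]"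
  define ts where "ts = sp @ r1 @ r2 @ r3"
  define C where "C = triple_cover (6 * (4 * u + 19) + 5) ts"
  have sp: "{3, 4, 6, 2 * u + 5, 2 * u + 7, 2 * u + 9, 2 * u + 11, 2 * u + 13,
    4 * u + 16, 4 * u + 17, 4 * u + 18, 4 * u + 19, 4 * u + 20, 4 * u + 21, 5 * u + 23, 5 * u + 24,
    5 * u + 25, 5 * u + 26, 5 * u + 27, 5 * u + 28, 5 * u + 29, 5 * u + 30, 6 * u + 31, 6 * u + 32,
    6 * u + 33, 6 * u + 34, 7 * u + 35, 7 * u + 36, 8 * u + 38, 8 * u + 39, 8 * u + 40, 8 * u + 41,
    8 * u + 42, 10 * u + 47, 10 * u + 48, 10 * u + 49, 10 * u + 50, 10 * u + 51, 10 * u + 52, 10 * u + 53,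
    12 * u + 58, 12 * u + 59} \<subseteq> C"
    by (simp add: C_def ts_def sp_def)
  have low: "d \<in> C" if "3 \<le> d" "d < 4 * u + 16" for d
  proof (cases "even d")
    case True
    then have "d = 4 \<or> d = 6 \<or> (8 \<le> d \<and> d < 4 * u + 16)"
      using that by presburger
    then show ?thesis
      using sp triple_run_cover_fst[of _ d] True
      by (elim disjE) (auto simp: C_def ts_def run_defs)
  next
    case False
    then have "d = 3 \<or> d = 2 * u + 5 \<or> d = 2 * u + 7 \<or> d = 2 * u + 9 \<or> d = 2 * u + 11 \<or>
        d = 2 * u + 13 \<or> (2 * u + 15 \<le> d \<and> d < 4 * u + 17) \<or> (5 \<le> d \<and> d < 2 * u + 5)"
      using that by presburger
    then show ?thesis
      using sp triple_run_cover_fst[of _ d] False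
      by (elim disjE) (auto simp: C_def ts_def run_defs)
  qed
  have "{3..<4 * u + 16} \<subseteq> C"
    using low by auto
  also have "{4 * u + 16..<4 * u + 22} \<subseteq> C"
    by (rule subset_trans[OF _ sp]) (simp add: subset_iff, presburger)
  also have "{4 * u + 22..<5 * u + 23} \<subseteq> C"
    using triple_run_cover_snd[of "5 * u + 23" "4 * u + 22" "u + 1"]
    by (fastforce simp: C_def ts_def run_defs)
  also have "{5 * u + 23..<5 * u + 31} \<subseteq> C"
    by (rule subset_trans[OF _ sp]) (simp add: subset_iff, presburger)
  also have "{5 * u + 31..<6 * u + 31} \<subseteq> C"
    using triple_run_cover_snd[of "6 * u + 31" "5 * u + 31" "u"]
    by (fastforce simp: C_def ts_def run_defs)
  also have "{6 * u + 31..<6 * u + 35} \<subseteq> C"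
    by (rule subset_trans[OF _ sp]) (simp add: subset_iff, presburger)
  also have "{6 * u + 35..<7 * u + 35} \<subseteq> C"
    using triple_run_cover_thd[of "6 * u + 35" "u"]
    by (fastforce simp: C_def ts_def run_defs)
  also have "{7 * u + 35..<7 * u + 37} \<subseteq> C"
    by (rule subset_trans[OF _ sp]) (simp add: subset_iff, presburger)
  also have "{7 * u + 37..<8 * u + 38} \<subseteq> C"
    using triple_run_cover_thd[of "7 * u + 37" "u + 1"]
    by (fastforce simp: C_def ts_def run_defs)
  also have "{8 * u + 38..<8 * u + 43} \<subseteq> C"
    by (rule subset_trans[OF _ sp]) (simp add: subset_iff, presburger)
  also have "{8 * u + 43..<10 * u + 47} \<subseteq> C"
    using triple_run_cover_snd[of "10 * u + 47" "8 * u + 43" "2 * u + 4"]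
    by (fastforce simp: C_def ts_def run_defs)
  also have "{10 * u + 47..<10 * u + 54} \<subseteq> C"
    by (rule subset_trans[OF _ sp]) (simp add: subset_iff, presburger)
  also have "{10 * u + 54..<12 * u + 58} \<subseteq> C"
    using triple_run_cover_thd[of "10 * u + 54" "2 * u + 4"]
    by (fastforce simp: C_def ts_def run_defs)
  also have "{12 * u + 58..<12 * u + 60} \<subseteq> C"
    by (rule subset_trans[OF _ sp]) (simp add: subset_iff, presburger)
  finally have "{3..<3 * (4 * u + 19) + 3} \<subseteq> C" by (simp add: add.commute)
  moreover have "\<forall>(a, b, c)\<in>set ts. a + b = c"
    by (auto simp: ts_def sp_def run_defs dest: triple_run_sum)
  moreover have "length ts = 4 * u + 19"
    by (simp add: ts_def sp_def run_defs)
  ultimately show ?thesis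
    by (auto simp: difference_triples_def C_def)
qed

section \<open>Langford triples for 5 <= m < 16, and all cases together\<close>

text \<open>In the general pattern \<open>u\<close> would be negative for these \<open>m\<close>,
  and with it the length of the run \<open>r3\<close>, so explicit lists are given. For m = 2 or 3
  modulo 4 one triple has the hooked sum 3m + 3.\<close>

lemma difference_triples_small:
  assumes "m \<in> {5..<16}"
  shows "\<exists>ts. difference_triples m ts"
proof -
  have t5: "difference_triples 5
     [(7, 8, 15), (6, 10, 16), (5, 12, 17), (4, 9, 13), (3, 11, 14)]"
    by code_simp
  have t6: "difference_triples 6
     [(8, 9, 17), (7, 11, 18), (6, 13, 19), (5, 16, 21), (4, 10, 14), (3, 12, 15)]"
    by code_simp
  have t7: "difference_triples 7
     [(9, 10, 19), (8, 12, 20), (7, 14, 21), (6, 18, 24), (5, 17, 22), (4, 11, 15),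
      (3, 13, 16)]"
    by code_simp
  have t8: "difference_triples 8
     [(10, 11, 21), (9, 13, 22), (8, 15, 23), (7, 18, 25), (6, 20, 26), (5, 19, 24),
      (4, 12, 16), (3, 14, 17)]"
    by code_simp
  have t9: "difference_triples 9
     [(11, 12, 23), (10, 14, 24), (9, 17, 26), (8, 19, 27), (7, 13, 20), (6, 22, 28),
      (5, 16, 21), (4, 25, 29), (3, 15, 18)]"
    by code_simp
  have t10: "difference_triples 10
     [(12, 13, 25), (11, 15, 26), (10, 17, 27), (9, 20, 29), (8, 23, 31), (7, 14, 21),
      (6, 24, 30), (5, 28, 33), (4, 18, 22), (3, 16, 19)]"
    by code_simp
  have t11: "difference_triples 11
     [(13, 14, 27), (12, 16, 28), (11, 18, 29), (10, 20, 30), (9, 23, 32), (8, 26, 34),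
      (7, 15, 22), (6, 25, 31), (5, 19, 24), (4, 17, 21), (3, 33, 36)]"
    by code_simp
  have t12: "difference_triples 12
     [(14, 15, 29), (13, 17, 30), (12, 19, 31), (11, 21, 32), (10, 24, 34), (9, 27, 36),
      (8, 18, 26), (7, 16, 23), (6, 22, 28), (5, 20, 25), (4, 33, 37), (3, 35, 38)]"
    by code_simp
  have t13: "difference_triples 13
     [(15, 16, 31), (14, 18, 32), (13, 20, 33), (12, 22, 34), (11, 24, 35), (10, 29, 39),
      (9, 17, 26), (8, 30, 38), (7, 21, 28), (6, 19, 25), (5, 36, 41), (4, 23, 27),
      (3, 37, 40)]"
    by code_simp
  have t14: "difference_triples 14
     [(16, 17, 33), (15, 19, 34), (14, 18, 32), (13, 23, 36), (12, 25, 37), (11, 27, 38),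
      (10, 29, 39), (9, 22, 31), (8, 20, 28), (7, 35, 42), (6, 24, 30), (5, 21, 26),
      (4, 41, 45), (3, 40, 43)]"
    by code_simp
  have t15: "difference_triples 15
     [(17, 18, 35), (16, 20, 36), (15, 19, 34), (14, 23, 37), (13, 26, 39), (12, 28, 40),
      (11, 27, 38), (10, 33, 43), (9, 21, 30), (8, 24, 32), (7, 22, 29), (6, 25, 31),
      (5, 41, 46), (4, 44, 48), (3, 42, 45)]"
    by code_simp
  have "m = 5 \<or> m = 6 \<or> m = 7 \<or> m = 8 \<or> m = 9 \<or> m = 10 \<or> m = 11 \<or> m = 12 \<or> m = 13 \<or> m = 14 \<or> m = 15"
    using assms unfolding atLeastLessThan_iff by presburger
  then show ?thesis
    using t5 t6 t7 t8 t9 t10 t11 t12 t13 t14 t15 by blast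
qed

lemma difference_triples_exist:
  assumes "m \<ge> 5"
  shows "\<exists>ts. difference_triples m ts"
proof (cases "m < 16")
  case True
  then show ?thesis using assms difference_triples_small by simp
next
  case False
  then obtain k where "m = 16 + k"
    by (metis le_add_diff_inverse not_less)
  then have "m = 4 * (k div 4) + 16 \<or> m = 4 * (k div 4) + 17 \<or>
      m = 4 * (k div 4) + 18 \<or> m = 4 * (k div 4) + 19"
    by presburger
  then show ?thesis
    using difference_triples_mod4_0 difference_triples_mod4_1
      difference_triples_mod4_2 difference_triples_mod4_3 by metis
qed

section \<open>Triple systems with a tight number of lines\<close>

lemma offdiag_card:
  assumes "finite A"
  shows "card {(x, y). x \<in> A \<and> y \<in> A \<and> x \<noteq> y} = card A * (card A - 1)"
proof -
  have "{(x, y). x \<in> A \<and> y \<in> A \<and> x \<noteq> y} = (SIGMA x:A. A - {x})" by auto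
  then show ?thesis using assms by simp
qed

text \<open>\<open>N x\<close> is the intended opposite line. A point of PENT(3, r) is collinear
  with 2r points and misses 3, whence 2r + 4 points. Sizes of lines and their number are only
  bounded above, so that a construction need not check that its points or lines are
  distinct.\<close>

locale tight_triple_cover =
  fixes V :: "'a set" and \<L> :: "'a set set" and N :: "'a \<Rightarrow> 'a set" and r :: nat
  assumes fin: "finite V" "finite \<L>"
    and lines: "L \<in> \<L> \<Longrightarrow> L \<subseteq> V \<and> card L \<le> 3"
    and leave: "x \<in> V \<Longrightarrow> N x \<in> \<L> \<and> x \<notin> N x"
    and cover: "x \<in> V \<Longrightarrow> y \<in> V \<Longrightarrow> x \<noteq> y \<Longrightarrow> y \<notin> N x \<Longrightarrow> collinear_in \<L> x y"
    and count: "card V = 2 * r + 4" "3 * card \<L> \<le> card V * r"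
begin

text \<open>Double counting of ordered pairs: at least 2r|V| pairs, collected in \<open>S\<close>,
  must be joined, and each line joins at most 6. Since 6|\<L>| \<le> 2r|V|, every inequality is an
  equality.\<close>

lemma
  shows line_card_3: "\<And>L. L \<in> \<L> \<Longrightarrow> card L = 3"
    and line_unique: "\<And>x y L M. x \<noteq> y \<Longrightarrow> L \<in> \<L> \<Longrightarrow> x \<in> L \<Longrightarrow> y \<in> L \<Longrightarrow>
      M \<in> \<L> \<Longrightarrow> x \<in> M \<Longrightarrow> y \<in> M \<Longrightarrow> L = M"
    and leave_not_collinear: "\<And>x y. x \<in> V \<Longrightarrow> y \<in> N x \<Longrightarrow> \<not> collinear_in \<L> x y"
proof -
  define P where "P L = {(x, y). x \<in> L \<and> y \<in> L \<and> x \<noteq> y}" for L :: "'a set"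
  define S where "S = (SIGMA x:V. V - insert x (N x))"
  have finL: "finite L" if "L \<in> \<L>" for L
    using that lines fin(1) finite_subset by blast
  have finP: "finite (P L)" if "L \<in> \<L>" for L
    using finL[OF that] by (auto simp: P_def intro: finite_subset[of _ "L \<times> L"])
  have cardP: "card (P L) = card L * (card L - 1)" if "L \<in> \<L>" for L
    unfolding P_def using finL[OF that] by (rule offdiag_card)
  have leP: "card (P L) \<le> 6" if "L \<in> \<L>" for L
  proof -
    have "card L * (card L - 1) \<le> 3 * 2"
      using lines[OF that] by (intro mult_le_mono) auto
    then show ?thesis by (simp add: cardP[OF that])
  qed
  have cardS: "2 * (card V * r) \<le> card S"
  proof -
    have "2 * r \<le> card (V - insert x (N x))" if "x \<in> V" for x
    proof -
      have *: "N x \<in> \<L>" using leave[OF that] by blast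
      have "card (insert x (N x)) \<le> 4"
        using lines[OF *] card_insert_le_m1[of 4 "N x" x] by simp
      moreover have "card (V - insert x (N x)) = card V - card (insert x (N x))"
        using lines[OF *] that finL[OF *] by (intro card_Diff_subset) auto
      ultimately show ?thesis using count(1) by simp
    qed
    then have "(\<Sum>x\<in>V. 2 * r) \<le> card S"
      unfolding S_def using fin(1) by (simp add: sum_mono del: sum_constant)
    then show ?thesis by simp
  qed
  \<comment> \<open>Pairs are kept together with their line, so that a pair joined by two lines is
    counted twice and shows up as a failure of injectivity of \<open>snd\<close>.\<close>
  define Q where "Q = Sigma \<L> P"
  have cardQ: "card Q = (\<Sum>L\<in>\<L>. card (P L))"
    unfolding Q_def using fin(2) finP by simp
  also have "\<dots> \<le> (\<Sum>L\<in>\<L>. 6)" using leP by (intro sum_mono)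
  also have "\<dots> \<le> card S" using cardS count(2) by simp
  finally have QS: "card Q \<le> card S" .
  have finQ: "finite Q" unfolding Q_def using fin(2) finP by auto
  have sub: "S \<subseteq> snd ` Q"
  proof
    fix p assume "p \<in> S"
    then obtain x y where p: "p = (x, y)" "x \<in> V" "y \<in> V" "x \<noteq> y" "y \<notin> N x"
      by (auto simp: S_def)
    then obtain L where "L \<in> \<L>" "x \<in> L" "y \<in> L"
      using cover[of x y] by (auto simp: collinear_in_def)
    then show "p \<in> snd ` Q"
      using p by (force simp: Q_def P_def)
  qed
  have "card (snd ` Q) \<le> card Q" by (rule card_image_le[OF finQ])
  \<comment> \<open>\<open>S\<close> lies in the image of \<open>Q\<close>, and |image| \<le> |Q|
    \<le> |S|. Equality of the sets says that no pair of the leave is joined; equality of the sizes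
    gives injectivity.\<close>
  then have eq: "snd ` Q = S"
    using sub QS finQ card_seteq[of "snd ` Q" S] by auto
  then have "card (snd ` Q) = card Q"
    using QS \<open>card (snd ` Q) \<le> card Q\<close> by simp
  then have inj: "inj_on snd Q" by (rule eq_card_imp_inj_on[OF finQ])
  show "L = M" if "x \<noteq> y" "L \<in> \<L>" "x \<in> L" "y \<in> L" "M \<in> \<L>" "x \<in> M" "y \<in> M" for x y L M
    using inj_onD[OF inj, of "(L, (x, y))" "(M, (x, y))"] that by (simp add: Q_def P_def)
  show "\<not> collinear_in \<L> x y" if "x \<in> V" "y \<in> N x" for x y
  proof
    assume "collinear_in \<L> x y"
    then have "(x, y) \<in> snd ` Q" by (force simp: collinear_in_def Q_def P_def)
    then show False using eq that by (auto simp: S_def)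
  qed
  \<comment> \<open>The total reaches its termwise bound, so every term is 6, and k(k - 1) = 6 with
    k \<le> 3 forces k = 3.\<close>
  have "(\<Sum>L\<in>\<L>. card (P L)) = (\<Sum>L\<in>\<L>. 6)"
  proof (rule antisym)
    show "(\<Sum>L\<in>\<L>. card (P L)) \<le> (\<Sum>L\<in>\<L>. 6)" using leP by (intro sum_mono)
    show "(\<Sum>L\<in>\<L>. 6) \<le> (\<Sum>L\<in>\<L>. card (P L))"
      using cardS count(2) \<open>card (snd ` Q) = card Q\<close> eq cardQ by simp
  qed
  then have six: "card (P L) = 6" if "L \<in> \<L>" for L
    using sum_mono_inv[of "\<lambda>L. card (P L)" \<L> "\<lambda>_. 6" L] leP fin(2) that by auto
  show "card L = 3" if "L \<in> \<L>" for L
  proof -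
    have "card L = 0 \<or> card L = 1 \<or> card L = 2 \<or> card L = 3"
      using lines[OF that] by auto
    then show ?thesis using six[OF that] cardP[OF that] by auto
  qed
qed

lemma is_pentagonal_geometry:
  assumes "r \<ge> 1"
  shows "pentagonal_geometry V \<L> 3 r"
proof -
  have opp: "{y \<in> V. y \<noteq> x \<and> \<not> collinear_in \<L> x y} = N x" if "x \<in> V" for x
    using that leave[OF that] lines[of "N x"] cover leave_not_collinear by blast
  show ?thesis
  proof
    show "finite V" by (rule fin)
    show "V \<noteq> {}" using count(1) by auto
    show "L \<subseteq> V" if "L \<in> \<L>" for L using lines that by blast
    show "2 \<le> card L" if "L \<in> \<L>" for L using line_card_3[OF that] by simp
    show "L = M" if "x \<in> V" "y \<in> V" "x \<noteq> y" "L \<in> \<L>" "x \<in> L" "y \<in> L" "M \<in> \<L>" "x \<in> M" "y \<in> M" for x y L M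
      using line_unique that by blast
    show "(2::nat) \<le> 3" by simp
    show "1 \<le> r" by fact
    show "card L = 3" if "L \<in> \<L>" for L using line_card_3[OF that] .
    show "\<exists>L\<in>\<L>. L = {y \<in> V. y \<noteq> x \<and> \<not> collinear_in \<L> x y}" if "x \<in> V" for x
      using leave[OF that] opp[OF that] by blast
    show "card {L \<in> \<L>. x \<in> L} = r" if x: "x \<in> V" for x
    proof -
      let ?T = "{L \<in> \<L>. x \<in> L}"
      \<comment> \<open>The lines through \<open>x\<close>, with \<open>x\<close> removed, partition
        these 2r points into pairs, which gives the degree \<open>r\<close>.\<close>
      have "V - insert x (N x) = (\<Union>L\<in>?T. L - {x})"
      proof (intro equalityI subsetI)
        fix y assume "y \<in> V - insert x (N x)"
        then show "y \<in> (\<Union>L\<in>?T. L - {x})"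
          using cover[OF x, of y] by (auto simp: collinear_in_def)
      next
        fix y assume "y \<in> (\<Union>L\<in>?T. L - {x})"
        then obtain L where "L \<in> \<L>" "x \<in> L" "y \<in> L" "y \<noteq> x" by blast
        then show "y \<in> V - insert x (N x)"
          using lines[of L] leave_not_collinear[OF x, of y] by (auto simp: collinear_in_def)
      qed
      moreover have "card (\<Union>L\<in>?T. L - {x}) = (\<Sum>L\<in>?T. card (L - {x}))"
      proof (rule card_UN_disjoint)
        show "finite ?T" using fin(2) by simp
        show "\<forall>L\<in>?T. finite (L - {x})"
          using lines finite_subset[OF _ fin(1)] by blast
        show "\<forall>L\<in>?T. \<forall>M\<in>?T. L \<noteq> M \<longrightarrow> (L - {x}) \<inter> (M - {x}) = {}"
        proof (intro ballI impI, rule ccontr)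
          fix L M assume *: "L \<in> ?T" "M \<in> ?T" "L \<noteq> M" "(L - {x}) \<inter> (M - {x}) \<noteq> {}"
          then obtain y where "y \<noteq> x" "y \<in> L" "y \<in> M" by auto
          then show False using line_unique[of y x L M] * by simp
        qed
      qed
      moreover have "(\<Sum>L\<in>?T. card (L - {x})) = (\<Sum>L\<in>?T. 2)"
        using line_card_3 by (intro sum.cong) auto
      moreover have "card (V - insert x (N x)) = 2 * r"
      proof -
        have "N x \<in> \<L>" "N x \<subseteq> V" "x \<notin> N x" using leave[OF x] lines by auto
        then have "card (insert x (N x)) = 4" "insert x (N x) \<subseteq> V" "finite (insert x (N x))"
          using line_card_3[of "N x"] fin(1) x finite_subset[of "N x" V] by auto
        then show ?thesis using count(1) by (simp add: card_Diff_subset)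
      qed
      ultimately show ?thesis by simp
    qed
  qed
qed

end

section \<open>The cyclic construction\<close>

locale difference_triple_design =
  fixes m :: nat and ts :: "(nat \<times> nat \<times> nat) list"
  assumes difference_triples: "difference_triples m ts"
begin

definition n :: int where
  "n = 6 * int m + 5"

text \<open>Even numbers are the rim (\<open>False\<close>) and odd numbers the inner circle
  (\<open>True\<close>). The index is any integer and is reduced modulo \<open>n\<close>, so
  translations and negative offsets need no side conditions.\<close>

definition pt :: "bool \<Rightarrow> int \<Rightarrow> nat" where
  "pt s i = 2 * nat (i mod n) + of_bool s"

definition outer_line :: "int \<Rightarrow> nat set" where
  "outer_line i = {pt False (i - 1), pt False (i + 1), pt True i}"

definition spoke_line :: "int \<Rightarrow> int \<Rightarrow> nat set" where
  "spoke_line i x = {pt False i, pt True (i + x), pt True (i - x)}"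

text \<open>For a + b = c the offsets 0, a, c have differences a, b and c; \<open>b\<close>
  separates the last two points.\<close>

definition rim_line :: "int \<Rightarrow> nat \<times> nat \<times> nat \<Rightarrow> nat set" where
  "rim_line i = (\<lambda>(a, b, c). {pt False i, pt False (i + int a), pt False (i + int c)})"

definition design_points :: "nat set" where
  "design_points = {..<12 * m + 10}"

definition design_lines :: "nat set set" where
  "design_lines = (\<Union>i\<in>{0..<n}. insert (outer_line i) 
     (spoke_line i ` {2..3 * int m + 2} \<union> rim_line i ` set ts))"

text \<open>These are the neighbourhoods in the generalized Petersen graph: i - 1, i + 1 and a spoke
  on the rim, i - 2, i + 2 and a spoke inside. Halving \<open>p\<close> recovers the index from the
  encoding in \<open>pt\<close>.\<close>

definition opposite :: "nat \<Rightarrow> nat set" where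
  "opposite p = (if even p then outer_line (int (p div 2)) else spoke_line (int (p div 2)) 2)"

lemma n_pos: "n > 0"
  by (simp add: n_def)

lemma pt_eq_iff: "pt s i = pt t j \<longleftrightarrow> s = t \<and> i mod n = j mod n"
proof -
  have "2 * a + of_bool s = 2 * b + of_bool t \<longleftrightarrow> s = t \<and> a = b" for a b :: nat
    by (cases s; cases t) (simp_all, presburger+)
  then show ?thesis
    using n_pos by (simp add: pt_def eq_nat_nat_iff)
qed

lemma pt_cong: "i mod n = j mod n \<Longrightarrow> pt s i = pt s j"
  by (simp add: pt_def)

lemma pt_period: "pt s (i - n) = pt s i"
  by (rule pt_cong) (simp add: mod_eq_dvd_iff)

lemma pt_in_design_points: "pt s i \<in> design_points"
proof -
  have "i mod n < 6 * int m + 5" using n_pos pos_mod_bound[of n i] by (simp flip: n_def)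
  then have "nat (i mod n) < 6 * m + 5" by linarith
  then show ?thesis by (simp add: pt_def design_points_def)
qed

lemma design_pointsE:
  assumes "p \<in> design_points"
  obtains s i where "p = pt s i"
proof
  have "int (p div 2) < n" using assms by (auto simp: design_points_def n_def)
  then show "p = pt (odd p) (int (p div 2))"
    by (simp add: pt_def mod_pos_pos_trivial)
qed

lemma pt_mod:
  "pt s (i mod n) = pt s i" "pt s (i mod n + j) = pt s (i + j)" "pt s (i mod n - j) = pt s (i - j)"
  by (simp_all add: pt_def mod_simps)

lemma opposite_pt: "opposite (pt s i) = (if s then spoke_line i 2 else outer_line i)"
  using n_pos by (simp add: opposite_def pt_def[of s] outer_line_def spoke_line_def pt_mod)

text \<open>\<open>design_lines\<close> only ranges over the indices from 0 to n - 1; reduction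
  modulo \<open>n\<close> makes every integer index available.\<close>

lemma outer_line_in: "outer_line i \<in> design_lines"
proof -
  have "outer_line (i mod n) \<in> design_lines" using n_pos by (auto simp: design_lines_def)
  then show ?thesis by (simp add: outer_line_def pt_mod)
qed

lemma spoke_line_in:
  assumes "2 \<le> x" "x \<le> 3 * int m + 2"
  shows "spoke_line i x \<in> design_lines"
proof -
  have "spoke_line (i mod n) x \<in> design_lines"
    unfolding design_lines_def using n_pos assms by (intro UN_I[of "i mod n"]) auto
  then show ?thesis by (simp add: spoke_line_def pt_mod)
qed

lemma rim_line_in:
  assumes "t \<in> set ts"
  shows "rim_line i t \<in> design_lines"
proof -
  have "rim_line (i mod n) t \<in> design_lines"
    unfolding design_lines_def using n_pos assms by (intro UN_I[of "i mod n"]) auto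
  then show ?thesis by (simp add: rim_line_def pt_mod)
qed

section \<open>Every non-edge of the deficiency graph lies on a line\<close>

lemma joined_mixed:
  assumes "u mod n \<noteq> w mod n"
  shows "\<exists>L\<in>design_lines. pt False u \<in> L \<and> pt True w \<in> L"
proof -
  define d where "d = (w - u) mod n"
  have d: "0 \<le> d" "d < n" "d \<noteq> 0"
    using n_pos assms by (auto simp: d_def mod_eq_dvd_iff dvd_minus_iff dvd_diff_commute)
  have w: "pt s w = pt s (u + d)" "pt s u = pt s (w - d)" for s
    by (rule pt_cong, simp add: d_def mod_simps)+
  \<comment> \<open>Since n = 2(3m + 2) + 1, either \<open>d\<close> or \<open>n - d\<close> is at
    most 3m + 2. The differences 1 and -1 belong to outer lines, all others to spoke lines.\<close>
  consider "d = 1" | "d = n - 1" | "2 \<le> d" "d \<le> 3 * int m + 2" | "2 \<le> n - d" "n - d \<le> 3 * int m + 2"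
    using d n_def by linarith
  then show ?thesis
  proof cases
    case 1
    have "pt False u = pt False (w - 1)" using w(2)[of False] 1 by simp
    then show ?thesis by (intro bexI[OF _ outer_line_in[of w]]) (simp add: outer_line_def)
  next
    case 2
    have "pt False u = pt False (w + 1)"
      using w(2)[of False] 2 pt_period[of False "w + 1"] by (simp add: algebra_simps)
    then show ?thesis by (intro bexI[OF _ outer_line_in[of w]]) (simp add: outer_line_def)
  next
    case 3
    then show ?thesis using w(1)[of True]
      by (intro bexI[OF _ spoke_line_in[of d u]]) (simp_all add: spoke_line_def)
  next
    case 4
    have "pt True w = pt True (u - (n - d))"
      using w(1)[of True] pt_period[of True "u + d"] by (simp add: algebra_simps)
    then show ?thesis using 4
      by (intro bexI[OF _ spoke_line_in[of "n - d" u]]) (simp_all add: spoke_line_def)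
  qed
qed

text \<open>As \<open>n\<close> is odd, one of w - u and u - w has an even residue 2x. The spoke
  line based at the midpoint then joins the two points; x = 0 and x = 1 are the excluded differences
  0 and 2.\<close>

lemma joined_inner:
  assumes "u mod n \<noteq> w mod n" "(u + 2) mod n \<noteq> w mod n" "(w + 2) mod n \<noteq> u mod n"
  shows "\<exists>L\<in>design_lines. pt True u \<in> L \<and> pt True w \<in> L"
proof -
  have main: "\<exists>L\<in>design_lines. pt True u \<in> L \<and> pt True w \<in> L"
    if "even ((w - u) mod n)" "u mod n \<noteq> w mod n" "(u + 2) mod n \<noteq> w mod n" for u w
  proof -
    obtain x where x: "(w - u) mod n = 2 * x" using \<open>even ((w - u) mod n)\<close> by blast
    have w: "pt s w = pt s (u + 2 * x)" for s
      unfolding x[symmetric] by (rule pt_cong) (simp add: mod_simps)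
    have "0 \<le> 2 * x" "2 * x < n" using n_pos by (simp_all flip: x)
    moreover have "x \<noteq> 0" using w[of True] that(2) by (auto simp: pt_eq_iff)
    moreover have "x \<noteq> 1" using w[of True] that(3) by (auto simp: pt_eq_iff)
    ultimately have "2 \<le> x" "x \<le> 3 * int m + 2" using n_def by auto
    then show ?thesis
      using w[of True] by (intro bexI[OF _ spoke_line_in[of x "u + x"]]) (simp_all add: spoke_line_def algebra_simps)
  qed
  show ?thesis
  proof (cases "even ((w - u) mod n)")
    case True
    then show ?thesis using main assms by blast
  next
    case False
    have "(u - w) mod n = n - (w - u) mod n"
      using zmod_zminus1_eq_if[of "w - u" n] False by (auto split: if_splits)
    then have "even ((u - w) mod n)" using False by (simp add: n_def)
    then show ?thesis using main[of u w] main[of w u] assms by metis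
  qed
qed

text \<open>Up to sign the difference is at most 3m + 2. The value 2 comes from an outer line, and
  larger values from the Langford triples.\<close>

lemma joined_rim:
  assumes "u mod n \<noteq> w mod n" "(u + 1) mod n \<noteq> w mod n" "(w + 1) mod n \<noteq> u mod n"
  shows "\<exists>L\<in>design_lines. pt False u \<in> L \<and> pt False w \<in> L"
proof -
  have main: "\<exists>L\<in>design_lines. pt False u \<in> L \<and> pt False w \<in> L"
    if "(w - u) mod n \<le> 3 * int m + 2" "u mod n \<noteq> w mod n" "(u + 1) mod n \<noteq> w mod n" for u w
  proof -
    define d where "d = nat ((w - u) mod n)"
    have d: "int d = (w - u) mod n" using n_pos by (simp add: d_def)
    have w: "pt s w = pt s (u + int d)" for s
      unfolding d by (rule pt_cong) (simp add: mod_simps)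
    have w': "pt s u = pt s (w - int d)" for s
      unfolding d by (rule pt_cong) (simp add: mod_simps)
    have "d \<noteq> 0"
    proof
      assume "d = 0"
      then show False using w[of True] that(2) by (simp add: pt_eq_iff)
    qed
    moreover have "d \<noteq> 1" using w[of True] that(3) by (auto simp: pt_eq_iff)
    moreover have "d < 3 * m + 3" using that(1) d by linarith
    ultimately have "d = 2 \<or> d \<in> {3..<3 * m + 3}" by auto
    then show ?thesis
    proof
      assume "d = 2"
      then show ?thesis using w[of False]
        by (intro bexI[OF _ outer_line_in[of "u + 1"]]) (simp add: outer_line_def algebra_simps)
    next
      assume "d \<in> {3..<3 * m + 3}"
      then obtain a b c where t: "(a, b, c) \<in> set ts" and "d = a \<or> d = b \<or> d = c \<or> d = 6 * m + 5 - c"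
        using difference_triples
        unfolding difference_triples_def triple_cover_def by blast
      then consider "d = a" | "d = b" | "d = c" | "d = 6 * m + 5 - c" by blast
      then show ?thesis
      proof cases
        case 1
        then show ?thesis using w[of False]
          by (intro bexI[OF _ rim_line_in[OF t, of u]]) (simp add: rim_line_def)
      next
        case 2
        have "a + b = c" using t difference_triples by (auto simp: difference_triples_def)
        \<comment> \<open>Difference \<open>b\<close> lies between the second and third points of a
          triangle, so the triangle is translated to have its second point at
          \<open>u\<close>.\<close>
        then have shift: "u - int a + int c = u + int d" using \<open>d = b\<close> by simp
        have "pt False w = pt False (u - int a + int c)"
          unfolding shift by (rule w)
        then show ?thesis
          by (intro bexI[OF _ rim_line_in[OF t, of "u - int a"]]) (simp add: rim_line_def)
      next
        case 3
        then show ?thesis using w[of False]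
          by (intro bexI[OF _ rim_line_in[OF t, of u]]) (simp add: rim_line_def)
      next
        case 4
        \<comment> \<open>Because \<open>d\<close> is nonzero, the subtraction defining it was not
          truncated. Modulo \<open>n\<close> this makes \<open>u\<close> equal to w + c, so the
          triangle starts at \<open>w\<close>.\<close>
        then have shift: "w - int d = w + int c - n" using \<open>d \<noteq> 0\<close> by (simp add: n_def)
        have "pt False u = pt False (w + int c)"
          unfolding w'[of False] shift by (rule pt_period)
        then show ?thesis
          by (intro bexI[OF _ rim_line_in[OF t, of w]]) (simp add: rim_line_def)
      qed
    qed
  qed
  show ?thesis
  proof (cases "(w - u) mod n \<le> 3 * int m + 2")
    case True
    then show ?thesis using main assms by blast
  next
    case False
    have "(u - w) mod n = n - (w - u) mod n"
      using zmod_zminus1_eq_if[of "w - u" n] False by (auto split: if_splits)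
    then have "(u - w) mod n \<le> 3 * int m + 2" using False n_def by linarith
    then have "\<exists>L\<in>design_lines. pt False w \<in> L \<and> pt False u \<in> L"
      using assms by (intro main) simp_all
    then show ?thesis by blast
  qed
qed

section \<open>The line count and the resulting geometry\<close>

text \<open>Each translate contributes one outer line, 3m + 1 spoke lines and at most m rim lines.
  Three times this bound is 2n(6m + 3), the number allowed by \<open>count\<close>.\<close>

lemma card_design_lines: "card design_lines \<le> nat n * (4 * m + 2)"
proof -
  have "card (insert (outer_line i) (spoke_line i ` {2..3 * int m + 2} \<union> rim_line i ` set ts)) \<le> 4 * m + 2" for i
  proof -
    have "card (spoke_line i ` {2..3 * int m + 2}) \<le> 3 * m + 1"
      using card_image_le[of "{2..3 * int m + 2}" "spoke_line i"] by simp
    moreover have "card (rim_line i ` set ts) \<le> m"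
      using card_image_le[of "set ts" "rim_line i"] card_length[of ts] difference_triples
      by (simp add: difference_triples_def)
    ultimately have "card (spoke_line i ` {2..3 * int m + 2} \<union> rim_line i ` set ts) \<le> 4 * m + 1"
      using card_Un_le[of "spoke_line i ` {2..3 * int m + 2}" "rim_line i ` set ts"] by simp
    then show ?thesis by (simp add: card_insert_if)
  qed
  then have "card design_lines \<le> (\<Sum>i\<in>{0..<n}. 4 * m + 2)"
    unfolding design_lines_def by (intro order_trans[OF card_UN_le] sum_mono) auto
  then show ?thesis by simp
qed

sublocale tight_triple_cover design_points design_lines opposite "6 * m + 3"
proof
  show "finite design_points" by (simp add: design_points_def)
  show "finite design_lines" by (simp add: design_lines_def)
  show "card design_points = 2 * (6 * m + 3) + 4" by (simp add: design_points_def)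
  show "3 * card design_lines \<le> card design_points * (6 * m + 3)"
    using card_design_lines by (simp add: design_points_def n_def nat_add_distrib nat_mult_distrib algebra_simps)
  show "L \<subseteq> design_points \<and> card L \<le> 3" if "L \<in> design_lines" for L
    using that card_insert_le_m1
    by (auto simp: design_lines_def outer_line_def spoke_line_def rim_line_def pt_in_design_points card_insert_if)
  fix x y assume "x \<in> design_points"
  then obtain s u where x: "x = pt s u" by (rule design_pointsE)
  \<comment> \<open>As n \<ge> 5, offsets 1 and 2 in either direction move every point, so no point
    lies on its opposite line.\<close>
  have no: "k mod n \<noteq> 0" if "k \<in> {1, -1, 2, -2}" for k
    using that n_def zdvd_not_zless[of 1 n] zdvd_not_zless[of 2 n] 
    by (auto simp: mod_eq_0_iff_dvd)
  have "u mod n \<noteq> (u + k) mod n" if "k \<in> {1, -1, 2, -2}" for k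
    using no[OF that] by (auto simp: mod_eq_dvd_iff mod_eq_0_iff_dvd)
  from this[of 1] this[of "-1"] this[of 2] this[of "-2"]
  show "opposite x \<in> design_lines \<and> x \<notin> opposite x"
    unfolding x opposite_pt using outer_line_in spoke_line_in[of 2]
    by (auto simp: outer_line_def spoke_line_def pt_eq_iff)
  assume "y \<in> design_points" "x \<noteq> y" "y \<notin> opposite x"
  then obtain t w where y: "y = pt t w" by (auto elim: design_pointsE)
  have sh: "w mod n \<noteq> (u - k) mod n \<longleftrightarrow> (w + k) mod n \<noteq> u mod n" for k
    by (auto simp: mod_eq_dvd_iff algebra_simps)
  \<comment> \<open>Lying off the opposite line excludes just the differences left open by the
    joining lemmas: 0 for mixed pairs, 2 and -2 inside, 1 and -1 on the rim.\<close>
  have "\<exists>L\<in>design_lines. x \<in> L \<and> y \<in> L"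
    using \<open>x \<noteq> y\<close> \<open>y \<notin> opposite x\<close> joined_mixed[of u w] joined_mixed[of w u]
      joined_inner[of u w] joined_rim[of u w] sh[of 1] sh[of 2]
    unfolding x y opposite_pt
    by (cases s; cases t) (auto simp: outer_line_def spoke_line_def pt_eq_iff)
  then show "collinear_in design_lines x y"
    using \<open>x \<noteq> y\<close> by (auto simp: collinear_in_def)
qed

section \<open>Connectedness of the deficiency graph\<close>

text \<open>Walking along the rim in steps of 1 and then possibly along a spoke reaches every point
  from rim point 0; symmetry gives the way back.\<close>

lemma connected_deficiency_graph:
  "Digraph_Component.connected (with_proj (deficiency_graph design_points design_lines))"
proof -
  let ?G = "deficiency_graph design_points design_lines"
  \<comment> \<open>\<open>connected\<close> means strong connectedness of the symmetric closure, so
    reachability is argued there.\<close>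
  let ?H = "mk_symmetric (with_proj ?G)"
  interpret pentagonal_geometry design_points design_lines 3 "6 * m + 3"
    by (rule is_pentagonal_geometry) simp
  interpret G: pair_graph ?G by (rule pair_graph_deficiency_graph)
  have wf: "wf_digraph (with_proj ?H)"
    unfolding wf_digraph_wp_iff by (rule G.wellformed_mk_symmetric)
  have step: "pt s i \<rightarrow>\<^bsub>?H\<^esub> pt t j" if "pt t j \<in> opposite (pt s i)" for s t i j
  proof -
    have "(pt s i, pt t j) \<in> parcs ?G"
      using that leave[OF pt_in_design_points[of s i]] pt_in_design_points
        leave_not_collinear[OF pt_in_design_points that]
      by (auto simp: deficiency_graph_def)
    then show ?thesis by (auto simp: parcs_mk_symmetric)
  qed
  have rim: "pt False 0 \<rightarrow>\<^sup>*\<^bsub>?H\<^esub> pt False (int k)" for k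
  proof (induction k)
    case 0
    show ?case
      using wf_digraph.reachable_refl[OF wf, of "pt False 0"] pt_in_design_points
      by (simp add: deficiency_graph_def)
  next
    case (Suc k)
    have "pt False (int k) \<rightarrow>\<^bsub>?H\<^esub> pt False (int (Suc k))"
      by (rule step) (simp add: opposite_pt outer_line_def add.commute)
    with Suc.IH show ?case by (rule wf_digraph.reachable_adj_trans[OF wf])
  qed
  have all: "pt False 0 \<rightarrow>\<^sup>*\<^bsub>?H\<^esub> p" if p_in: "p \<in> design_points" for p
  proof -
    obtain s i where p: "p = pt s i" using p_in by (rule design_pointsE)
    have False_i: "pt False 0 \<rightarrow>\<^sup>*\<^bsub>?H\<^esub> pt False i"
      using rim[of "nat (i mod n)"] n_pos by (simp add: pt_mod)
    moreover have "pt False i \<rightarrow>\<^bsub>?H\<^esub> pt True i"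
      by (rule step) (simp add: opposite_pt outer_line_def)
    ultimately have "pt False 0 \<rightarrow>\<^sup>*\<^bsub>?H\<^esub> pt True i" by (rule wf_digraph.reachable_adj_trans[OF wf])
    with False_i show ?thesis unfolding p by (cases s) auto
  qed
  show ?thesis
    unfolding connected_def
  proof (rule strongly_connectedI)
    show "verts ?H \<noteq> {}" using pt_in_design_points by (auto simp: deficiency_graph_def)
    fix u v assume "u \<in> verts ?H" "v \<in> verts ?H"
    then have uv: "u \<in> design_points" "v \<in> design_points" by (simp_all add: deficiency_graph_def)
    from symmetric_mk_symmetric all[OF uv(1)] have "u \<rightarrow>\<^sup>*\<^bsub>?H\<^esub> pt False 0"
      by (rule symmetric_reachable)
    from wf_digraph.reachable_trans[OF wf this all[OF uv(2)]]
    show "u \<rightarrow>\<^sup>*\<^bsub>?H\<^esub> v" .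
  qed
qed

end

theorem theorem2p1:
  fixes m :: nat
  assumes "m \<ge> 5"
  shows "\<exists>(points :: nat set) (lines :: nat set set).
    pentagonal_geometry points lines 3 (6 * m + 3) \<and>
    Digraph_Component.connected (with_proj (deficiency_graph points lines))"
proof -
  obtain ts where "difference_triples m ts"
    using difference_triples_exist[OF assms] by blast
  then interpret difference_triple_design m ts by unfold_locales
  show ?thesis
    using is_pentagonal_geometry connected_deficiency_graph by auto
qed

end
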